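(* Let $p \geq 5$ be a prime number. Then there is no triple of positive integers $(x,y,z)$ with $\gcd(x,y)=1$ and $xy < \sqrt{z/2}$ such that $$\left|\frac{4}{p} - \frac{x+y}{xy}\right| = \frac{1}{z}.$$ *)

theory Defs
  imports Complex_Main "HOL-Computational_Algebra.Primes"
begin

end

theory Submission
  imports Defs
begin

text \<open>
  Write \<open>n = x y\<close>, \<open>s = x + y\<close> and let \<open>D = \<bar>4 n - p s\<bar>\<close> be the numerator of the error, so that the
  equation says \<open>z D = p n\<close>. The bound on \<open>x y\<close> says \<open>2 n\<^sup>2 < z\<close>; multiplied by \<open>D\<close>, it becomes
  \<open>2 n D < p\<close>. So \<open>4/p\<close> would be approximated so well that both positive integers \<open>n\<close> and \<open>D\<close>
  are smaller than \<open>p/2\<close>. Hence \<open>p s \<le> 4 n + D < 5 p/2\<close>, which leaves only \<open>x = y = 1\<close>. But then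
  \<open>D = 2 p - 4\<close>, which is not below \<open>p/2\<close>.
\<close>

theorem theorem1p1:
  fixes p :: nat
  assumes "prime p" and "p \<ge> 5"
  shows "\<not> (\<exists>x y z :: nat. x > 0 \<and> y > 0 \<and> z > 0 \<and> gcd x y = 1 \<and>
           real x * real y < sqrt (real z / 2) \<and>
           \<bar>4 / real p - (real x + real y) / (real x * real y)\<bar> = 1 / real z)"
proof
  assume "\<exists>x y z :: nat. x > 0 \<and> y > 0 \<and> z > 0 \<and> gcd x y = 1 \<and>
           real x * real y < sqrt (real z / 2) \<and>
           \<bar>4 / real p - (real x + real y) / (real x * real y)\<bar> = 1 / real z"
  then obtain x y z :: nat where pos: "x > 0" "y > 0" "z > 0"
    and bound: "real x * real y < sqrt (real z / 2)"
    and eq: "\<bar>4 / real p - (real x + real y) / (real x * real y)\<bar> = 1 / real z"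
    by blast
  define n where "n = int x * int y"
  define s where "s = int x + int y"
  define D where "D = \<bar>4 * n - int p * s\<bar>"
  have n1: "n \<ge> 1"
    using mult_pos_pos[of "int x" "int y"] pos unfolding n_def by linarith
  have p5: "int p \<ge> 5"
    using assms(2) by simp
  have n_real: "real x * real y = real_of_int n" and s_real: "real x + real y = real_of_int s"
    by (simp_all add: n_def s_def)
  have "4 / real p - real_of_int s / real_of_int n
      = real_of_int (4 * n - int p * s) / (real p * real_of_int n)"
    using n1 p5 by (simp add: field_simps)
  then have "real_of_int D / (real p * real_of_int n) = 1 / real z"
    using eq n1 unfolding n_real s_real D_def by (simp add: abs_mult)
  then have "real_of_int (int z * D) = real_of_int (int p * n)"
    using n1 p5 pos by (simp add: field_simps)
  then have zD: "int z * D = int p * n"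
    by (simp only: of_int_eq_iff)
  have D1: "D \<ge> 1"
  proof -
    have "int z * D > 0"
      using zD n1 p5 by simp
    then show ?thesis
      by (simp add: zero_less_mult_iff)
  qed
  have "real_of_int n ^ 2 < real z / 2"
    using power_strict_mono[OF bound, of 2] n1 unfolding n_real by simp
  then have "real_of_int (2 * n ^ 2) < real_of_int (int z)"
    by simp
  then have "2 * n ^ 2 < int z"
    by (simp only: of_int_less_iff)
  then have "2 * n ^ 2 * D < int z * D"
    using D1 by simp
  then have "(2 * n * D) * n < int p * n"
    unfolding zD by (simp add: power2_eq_square mult_ac)
  then have small: "2 * n * D < int p"
    using n1 by (simp add: mult_ac)
  have n_small: "2 * n < int p"
    using small mult_left_mono[OF D1, of "2 * n"] n1 by linarith
  have D_small: "2 * D < int p"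
    using small mult_right_mono[of 2 "2 * n" D] n1 D1 by linarith
  have s_le: "s \<le> 2"
  proof (rule ccontr)
    assume "\<not> s \<le> 2"
    then have "int p * 3 \<le> int p * s"
      by (intro mult_left_mono) auto
    also have "\<dots> \<le> 4 * n + D"
      unfolding D_def by linarith
    finally show False
      using n_small D_small p5 by linarith
  qed
  then have "x = 1" "y = 1"
    using pos unfolding s_def by linarith+
  then have "D = \<bar>4 - int p * 2\<bar>"
    by (simp add: D_def n_def s_def)
  then show False
    using D_small p5 by linarith
qed

end
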